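(* Let $\mathcal U\subseteq\mathcal P(\omega)$ be an upper set, and let $\overline{\mathcal V}$ be an upper sequence on $\omega$ (a partial $\omega$-sequence of upper sets on $\omega$). Then $$\mathcal U\leq_{\mathrm{LT}}\overline{\mathcal V}\iff F\leq_{\mathrm{LT}}\overline{\mathcal V}\text{ for every }\mathcal U\text{-function }F\iff F\leq_{\mathrm{LT}}\overline{\mathcal V}\text{ for every total }\mathcal U\text{-function }F .$$
   Context: **Upper sets.** An upper set is a nonempty family $\mathcal U\subseteq\mathcal P(\omega)$, closed upwards under $\subseteq$, with $\emptyset\notin\mathcal U$. **$\mathcal U$-functions.** A $\mathcal U$-function is a partial multifunction $F\colon\subseteq\omega\rightrightarrows\omega$ such that $F(n)\in\mathcal U$ for every $n\in\mathrm{dom}(F)$; it is total if $\mathrm{dom}(F)=\omega$. ($F$ need not be computable in any sense.) **Upper sequences.** An upper sequence is a family $\overline{\mathcal U}=(\mathcal U_n)_{n\in I}$ of upper sets with $I\subseteq\omega$. An upper set is viewed as an upper sequence with a singleton index set (equivalently, as the constant sequence). A partial multifunction $F$ with nonempty values is viewed as the upper sequence indexed by $\mathrm{dom}(F)$ whose $n$-th term is the principal filter $\{A\subseteq\omega:F(n)\subseteq A\}$. **LT-game and $\leq_{\mathrm{LT}}$.** Fix a computable bijection $\langle-,-\rangle\colon\omega^2\to\omega$. For upper sequences $\overline{\mathcal U}=(\mathcal U_i)_{i\in I}$, $\overline{\mathcal V}=(\mathcal V_j)_{j\in J}$, the game $\mathfrak G(\overline{\mathcal U},\overline{\mathcal V})$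 has players Merlin versus the team Arthur–Nimue. Merlin first chooses $x_0\in I$ and $A\in\mathcal U_{x_0}$. At round $n=0,1,\dots$ Arthur plays either $\langle1,u_n\rangle$, terminating the game with output $u_n$, or $\langle0,u_n\rangle$ with $u_n\in J$ (a query); after a query Nimue chooses $B_n\in\mathcal V_{u_n}$ and Merlin replies with $x_{n+1}\in B_n$. Arthur sees only $x_0,\dots,x_n$, and his strategy is a partial computable function $\omega^{<\omega}\rightharpoonup\omega$; Nimue sees the whole history and her strategy is arbitrary. The Arthur–Nimue strategy wins if every play following it terminates legally (after finitely many rounds) with output in $A$, or Merlin violates the rules first. $\overline{\mathcal U}\leq_{\mathrm{LT}}\overline{\mathcal V}$ iff Arthur–Nimue have a winning strategy in $\mathfrak G(\overline{\mathcal U},\overline{\mathcal V})$. *)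

theory Defs
  imports Main "HOL-Library.Nat_Bijection"
begin

text \<open>
  Kleene's partial recursive functions. A term is evaluated on an argument list; a result of
  \<open>None\<close> means divergence. Applying a term to a list of unsuitable length may also give \<open>None\<close>,
  which does not enlarge the class of functions obtained in any fixed arity.
\<close>

datatype recf =
    Zero
  | Succ
  | Proj nat
  | Comp recf "recf list"
  | Prec recf recf
  | Mu recf

primrec reval :: "recf \<Rightarrow> nat list \<Rightarrow> nat option" where
  "reval Zero xs = Some 0"
| "reval Succ xs = (case xs of [x] \<Rightarrow> Some (Suc x) | _ \<Rightarrow> None)"
| "reval (Proj i) xs = (if i < length xs then Some (xs ! i) else None)"
| "reval (Comp f gs) xs = Option.bind (those (map (\<lambda>g. reval g xs) gs)) (reval f)"
| "reval (Prec f g) xs =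
    (case xs of
      [] \<Rightarrow> None
    | n # ys \<Rightarrow> rec_nat (reval f ys) (\<lambda>m r. Option.bind r (\<lambda>y. reval g (m # y # ys))) n)"
| "reval (Mu f) xs =
    (if \<exists>n. reval f (n # xs) = Some 0 \<and> (\<forall>m<n. \<exists>y>0. reval f (m # xs) = Some y)
     then Some (LEAST n. reval f (n # xs) = Some 0)
     else None)"

definition partial_computable :: "(nat list \<Rightarrow> nat option) \<Rightarrow> bool" where
  "partial_computable \<sigma> \<longleftrightarrow> (\<exists>f. \<forall>xs. \<sigma> xs = reval f [list_encode xs])"

definition upper_set :: "nat set set \<Rightarrow> bool" where
  "upper_set \<U> \<longleftrightarrow> \<U> \<noteq> {} \<and> {} \<notin> \<U> \<and> (\<forall>A\<in>\<U>. \<forall>B. A \<subseteq> B \<longrightarrow> B \<in> \<U>)"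

text \<open>A sequence \<open>(\<U>\<^sub>n)\<^sub>n\<^sub>\<in>\<^sub>I\<close> is a map with domain \<open>I\<close>; the index set may be empty.\<close>

type_synonym useq = "nat \<Rightarrow> nat set set option"

definition upper_sequence :: "useq \<Rightarrow> bool" where
  "upper_sequence \<U> \<longleftrightarrow> (\<forall>\<W>\<in>ran \<U>. upper_set \<W>)"

text \<open>The single index is \<open>0\<close>; which one is taken is immaterial up to \<open>LT\<close>-equivalence.\<close>

definition useq_of_upper_set :: "nat set set \<Rightarrow> useq" where
  "useq_of_upper_set \<U> = [0 \<mapsto> \<U>]"

text \<open>A partial multifunction is a map from its domain to sets of values.\<close>

type_synonym multifun = "nat \<Rightarrow> nat set option"

definition U_function :: "nat set set \<Rightarrow> multifun \<Rightarrow> bool" where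
  "U_function \<U> F \<longleftrightarrow> (\<forall>n\<in>dom F. the (F n) \<in> \<U>)"

definition total_U_function :: "nat set set \<Rightarrow> multifun \<Rightarrow> bool" where
  "total_U_function \<U> F \<longleftrightarrow> U_function \<U> F \<and> dom F = UNIV"

definition useq_of_multifun :: "multifun \<Rightarrow> useq" where
  "useq_of_multifun F = (\<lambda>n. map_option (\<lambda>B. {A. B \<subseteq> A}) (F n))"

text \<open>
  A completed round of the game consists of Arthur's query \<open>u\<^sub>n\<close>, Nimue's answer \<open>B\<^sub>n\<close> and Merlin's
  reply \<open>x\<^sub>n\<^sub>+\<^sub>1\<close>. Nimue's strategy takes \<open>x\<^sub>0\<close>, \<open>A\<close>, the completed rounds and the pending query.
\<close>

type_synonym round = "nat \<times> nat set \<times> nat"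
type_synonym arthur = "nat list \<Rightarrow> nat option"
type_synonym nimue = "nat \<Rightarrow> nat set \<Rightarrow> round list \<Rightarrow> nat \<Rightarrow> nat set"

definition visible :: "nat \<Rightarrow> round list \<Rightarrow> nat list" where
  "visible x0 h = x0 # map (\<lambda>(u, B, x). x) h"

text \<open>
  The positions, with Arthur to move, reached by plays that follow the strategies \<open>\<sigma>\<close> and \<open>\<nu>\<close>
  and in which no player has violated the rules.
\<close>

inductive position ::
  "useq \<Rightarrow> useq \<Rightarrow> arthur \<Rightarrow> nimue \<Rightarrow> nat \<Rightarrow> nat set \<Rightarrow> round list \<Rightarrow> bool"
  for \<U> \<V> \<sigma> \<nu>
where
  start: "\<lbrakk>x0 \<in> dom \<U>; A \<in> the (\<U> x0)\<rbrakk> \<Longrightarrow> position \<U> \<V> \<sigma> \<nu> x0 A []"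
| query: "\<lbrakk>position \<U> \<V> \<sigma> \<nu> x0 A h;
           \<sigma> (visible x0 h) = Some (prod_encode (0, u)); u \<in> dom \<V>;
           B = \<nu> x0 A h u; B \<in> the (\<V> u); x \<in> B\<rbrakk>
          \<Longrightarrow> position \<U> \<V> \<sigma> \<nu> x0 A (h @ [(u, B, x)])"

text \<open>
  Arthur's moves are coded by \<open>prod_encode (k, u)\<close>; no move, or one with \<open>k > 1\<close>, is illegal.
\<close>

definition winning_output :: "arthur \<Rightarrow> nat \<Rightarrow> nat set \<Rightarrow> round list \<Rightarrow> bool" where
  "winning_output \<sigma> x0 A h \<longleftrightarrow> (\<exists>u\<in>A. \<sigma> (visible x0 h) = Some (prod_encode (1, u)))"

definition legal_query ::
  "useq \<Rightarrow> arthur \<Rightarrow> nimue \<Rightarrow> nat \<Rightarrow> nat set \<Rightarrow> round list \<Rightarrow> bool" where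
  "legal_query \<V> \<sigma> \<nu> x0 A h \<longleftrightarrow>
    (\<exists>u\<in>dom \<V>. \<sigma> (visible x0 h) = Some (prod_encode (0, u)) \<and> \<nu> x0 A h u \<in> the (\<V> u))"

text \<open>
  Plays in which Merlin is the first to violate the rules are won by Arthur and Nimue, so a
  strategy is winning iff, as long as Merlin keeps to the rules, Arthur and Nimue never make an
  illegal move or a wrong output, and the play does not go on forever.
\<close>

definition winning_strategy :: "useq \<Rightarrow> useq \<Rightarrow> arthur \<Rightarrow> nimue \<Rightarrow> bool" where
  "winning_strategy \<U> \<V> \<sigma> \<nu> \<longleftrightarrow>
    (\<forall>x0 A h. position \<U> \<V> \<sigma> \<nu> x0 A h \<longrightarrow>
       winning_output \<sigma> x0 A h \<or> legal_query \<V> \<sigma> \<nu> x0 A h) \<and>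
    \<not> (\<exists>x0 A r. \<forall>n. position \<U> \<V> \<sigma> \<nu> x0 A (map r [0..<n]))"

definition LT_reducible :: "useq \<Rightarrow> useq \<Rightarrow> bool" (infix "\<le>\<^sub>L\<^sub>T" 50) where
  "\<U> \<le>\<^sub>L\<^sub>T \<V> \<longleftrightarrow> (\<exists>\<sigma> \<nu>. partial_computable \<sigma> \<and> winning_strategy \<U> \<V> \<sigma> \<nu>)"

end

theory Submission
  imports Defs "HOL-Library.Countable"
begin

text \<open>
  Merlin's opening move \<open>(x\<^sub>0, A)\<close> splits the game into independent games, one for each opening.
  Nimue sees both \<open>x\<^sub>0\<close> and \<open>A\<close>, so she may use unrelated strategies in these games; Arthur sees
  \<open>x\<^sub>0\<close> only. Hence a reduction is a partial computable \<open>\<sigma>\<close> such that, for every opening, the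
  strategy that \<open>\<sigma>\<close> prescribes after \<open>x\<^sub>0\<close> can be completed by some Nimue to one that wins against
  \<open>A\<close> (lemma \<open>LT_reducible_iff_beats\<close>).

  If \<open>\<U>\<close> is reducible and \<open>F\<close> is a \<open>\<U>\<close>-function, then every target set of the game for \<open>F\<close>
  belongs to \<open>\<U>\<close>, so Arthur may pretend that the opening number is the one of the game for \<open>\<U>\<close>.
  Conversely, suppose that \<open>\<U>\<close> is not reducible. Enumerate the programs as \<open>f\<^sub>0, f\<^sub>1, \<dots>\<close>. For each
  fixed \<open>n\<close>, playing as \<open>f\<^sub>n\<close> does after the opening number \<open>n\<close> is a computable way of playing the
  game for \<open>\<U>\<close>, so it fails against some \<open>A\<^sub>n \<in> \<U>\<close>, whatever Nimue does. The total \<open>\<U>\<close>-function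
  \<open>n \<mapsto> A\<^sub>n\<close> then defeats every program: Merlin opens with \<open>(n, A\<^sub>n)\<close> against \<open>f\<^sub>n\<close>. As
  \<open>\<U>\<close>-functions are arbitrary, any enumeration of the programs will do. In both directions the
  only change to Arthur's program is that the opening number is replaced by a constant
  (lemma \<open>partial_computable_replace_head\<close>).
\<close>

section \<open>Replacing the head of a coded list\<close>

definition Pred_recf :: recf where
  "Pred_recf = Prec Zero (Proj 0)"

definition Add_recf :: recf where
  "Add_recf = Prec (Proj 0) (Comp Succ [Proj 1])"

text \<open>
  The subtrahend comes first, because primitive recursion runs on the first argument.
\<close>

definition Sub_recf :: recf where
  "Sub_recf = Prec (Proj 0) (Comp Pred_recf [Proj 1])"

definition Triangle_recf :: recf where
  "Triangle_recf = Prec Zero (Comp Succ [Comp Add_recf [Proj 0, Proj 1]])"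

primrec Add_const_recf :: "nat \<Rightarrow> recf" where
  "Add_const_recf 0 = Proj 0"
| "Add_const_recf (Suc n) = Comp Succ [Add_const_recf n]"

lemma reval_Pred: "reval Pred_recf [n] = Some (n - 1)"
  by (induction n) (simp_all add: Pred_recf_def)

lemma reval_Add: "reval Add_recf [m, n] = Some (m + n)"
  by (induction m) (simp_all add: Add_recf_def)

lemma reval_Sub: "reval Sub_recf [m, n] = Some (n - m)"
  by (induction m) (simp_all add: Sub_recf_def reval_Pred)

lemma reval_Triangle: "reval Triangle_recf [n] = Some (triangle n)"
  by (induction n) (simp_all add: Triangle_recf_def reval_Add)

lemma reval_Add_const: "reval (Add_const_recf n) [m] = Some (m + n)"
  by (induction n) simp_all

text \<open>
  The code of \<open>x # xs\<close> is \<open>c = triangle k + x + 1\<close> for \<open>k = x + t\<close>, where \<open>t\<close> is the code of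
  \<open>xs\<close>. As \<open>x \<le> k\<close>, the number \<open>k\<close> is the least one with \<open>c \<le> triangle (k + 1)\<close>, and the difference
  \<open>triangle (k + 1) - c\<close> is \<open>k - x = t\<close>.
\<close>

definition Diagonal_recf :: recf where
  "Diagonal_recf = Mu (Comp Sub_recf [Comp Triangle_recf [Comp Succ [Proj 0]], Proj 1])"

definition Tail_recf :: recf where
  "Tail_recf = Comp Sub_recf [Proj 0, Comp Triangle_recf [Comp Succ [Diagonal_recf]]]"

definition Replace_head_recf :: "nat \<Rightarrow> recf" where
  "Replace_head_recf a =
     Comp (Add_const_recf (Suc a)) [Comp Triangle_recf [Comp (Add_const_recf a) [Tail_recf]]]"

lemma triangle_mono: "m \<le> n \<Longrightarrow> triangle m \<le> triangle n"
  unfolding triangle_def by (intro div_le_mono mult_le_mono) simp_all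

lemma reval_Diagonal:
  "reval Diagonal_recf [list_encode (x # xs)] = Some (x + list_encode xs)"
proof -
  let ?k = "x + list_encode xs"
  let ?c = "list_encode (x # xs)"
  have c: "?c = Suc (triangle ?k + x)"
    by (simp add: prod_encode_def)
  have eval: "reval (Comp Sub_recf [Comp Triangle_recf [Comp Succ [Proj 0]], Proj 1]) [n, ?c]
      = Some (?c - triangle (Suc n))" for n
    by (simp add: reval_Sub reval_Triangle del: list_encode.simps triangle_Suc)
  have zero: "?c - triangle (Suc ?k) = 0"
    unfolding c by simp
  have pos: "0 < ?c - triangle (Suc m)" if "m < ?k" for m
    using triangle_mono[of "Suc m" ?k] that unfolding c by linarith
  have least: "(LEAST n. ?c - triangle (Suc n) = 0) = ?k"
    using zero pos by (intro Least_equality) (assumption, metis not_le less_irrefl)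
  have ex: "\<exists>n. ?c - triangle (Suc n) = 0 \<and> (\<forall>m<n. \<exists>y>0. ?c - triangle (Suc m) = y)"
    using zero pos by blast
  show ?thesis
    unfolding Diagonal_recf_def reval.simps(6) eval option.inject
    using ex least by (simp only: if_True)
qed

lemma reval_Tail: "reval Tail_recf [list_encode (x # xs)] = Some (list_encode xs)"
proof -
  have "triangle (Suc (x + list_encode xs)) - list_encode (x # xs) = list_encode xs"
    by (simp add: prod_encode_def)
  then show ?thesis
    unfolding Tail_recf_def
    by (simp add: reval_Diagonal reval_Triangle reval_Sub
        del: list_encode.simps triangle_Suc)
qed

lemma reval_Replace_head:
  "reval (Replace_head_recf a) [list_encode (x # xs)] = Some (list_encode (a # xs))"
  unfolding Replace_head_recf_def
  by (simp add: reval_Tail reval_Add_const reval_Triangle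
      del: list_encode.simps(2) Add_const_recf.simps)
    (simp add: prod_encode_def add.commute)

lemma partial_computable_replace_head:
  assumes "partial_computable \<sigma>"
  obtains \<sigma>' where "partial_computable \<sigma>'" and "\<And>x xs. \<sigma>' (x # xs) = \<sigma> (a # xs)"
proof -
  from assms obtain f where f: "\<And>xs. \<sigma> xs = reval f [list_encode xs]"
    unfolding partial_computable_def by blast
  let ?g = "Comp f [Replace_head_recf a]"
  show thesis
  proof
    show "partial_computable (\<lambda>xs. reval ?g [list_encode xs])"
      unfolding partial_computable_def by blast
    show "reval ?g [list_encode (x # xs)] = \<sigma> (a # xs)" for x xs
      by (simp add: f reval_Replace_head del: list_encode.simps)
  qed
qed

section \<open>Splitting the game by openings\<close>

text \<open>
  Here \<open>\<tau>\<close> is Arthur's strategy after the opening, a function of Merlin's replies alone; it is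
  encoded as a strategy in the game whose only opening is \<open>(0, A)\<close>.
\<close>

definition beats :: "useq \<Rightarrow> arthur \<Rightarrow> nat set \<Rightarrow> bool" where
  "beats \<V> \<tau> A \<longleftrightarrow> (\<exists>\<nu>. winning_strategy [0 \<mapsto> {A}] \<V> (\<lambda>xs. \<tau> (tl xs)) \<nu>)"

text \<open>
  After the opening, a play depends on the first number and on the sequence on the left only
  through what the two strategies do from there on.
\<close>

lemma position_change_opening:
  assumes "position \<U> \<V> \<sigma> \<nu> x A h"
    and "y \<in> dom \<U>'" and "A \<in> the (\<U>' y)"
    and "\<And>xs. \<sigma>' (y # xs) = \<sigma> (x # xs)" and "\<And>h u. \<nu>' y A h u = \<nu> x A h u"
  shows "position \<U>' \<V> \<sigma>' \<nu>' y A h"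
  using assms
proof (induction rule: position.induct)
  case (start x0 A)
  then show ?case by (auto intro: position.start)
next
  case (query x0 A h u B x)
  then show ?case by (intro position.query) (auto simp: visible_def)
qed

lemma position_opening:
  "position \<U> \<V> \<sigma> \<nu> x A h \<Longrightarrow> x \<in> dom \<U> \<and> A \<in> the (\<U> x)"
  by (induction rule: position.induct) auto

lemma winning_strategy_beats:
  assumes win: "winning_strategy \<U> \<V> \<sigma> \<nu>" and x: "x \<in> dom \<U>" "A \<in> the (\<U> x)"
  shows "beats \<V> (\<lambda>xs. \<sigma> (x # xs)) A"
proof -
  let ?\<tau> = "\<lambda>xs. \<sigma> (x # tl xs)" and ?\<mu> = "\<lambda>_ _. \<nu> x A"
  have pos: "y = 0 \<and> A' = A \<and> position \<U> \<V> \<sigma> \<nu> x A h"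
    if p: "position [0 \<mapsto> {A}] \<V> ?\<tau> ?\<mu> y A' h" for y A' h
  proof -
    have "y = 0" "A' = A"
      using position_opening[OF p] by (auto split: if_splits)
    with p x show ?thesis
      by (auto intro: position_change_opening)
  qed
  have "winning_strategy [0 \<mapsto> {A}] \<V> ?\<tau> ?\<mu>"
    unfolding winning_strategy_def
  proof (intro conjI allI impI notI)
    fix y A' h
    assume "position [0 \<mapsto> {A}] \<V> ?\<tau> ?\<mu> y A' h"
    from pos[OF this] win
    show "winning_output ?\<tau> y A' h \<or> legal_query \<V> ?\<tau> ?\<mu> y A' h"
      unfolding winning_strategy_def winning_output_def legal_query_def visible_def list.sel
      by blast
  next
    assume "\<exists>y A' r. \<forall>n. position [0 \<mapsto> {A}] \<V> ?\<tau> ?\<mu> y A' (map r [0..<n])"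
    with pos win show False
      unfolding winning_strategy_def by blast
  qed
  then show ?thesis
    unfolding beats_def by auto
qed

lemma beats_winning_strategy:
  assumes "\<And>x A. x \<in> dom \<U> \<Longrightarrow> A \<in> the (\<U> x) \<Longrightarrow> beats \<V> (\<lambda>xs. \<sigma> (x # xs)) A"
  obtains \<nu> where "winning_strategy \<U> \<V> \<sigma> \<nu>"
proof -
  let ?\<tau> = "\<lambda>x xs. \<sigma> (x # tl xs)"
  have "\<forall>x A. \<exists>\<nu>. x \<in> dom \<U> \<and> A \<in> the (\<U> x) \<longrightarrow> winning_strategy [0 \<mapsto> {A}] \<V> (?\<tau> x) \<nu>"
    using assms unfolding beats_def by blast
  then obtain \<mu> where
    \<mu>: "\<And>x A. x \<in> dom \<U> \<Longrightarrow> A \<in> the (\<U> x) \<Longrightarrow> winning_strategy [0 \<mapsto> {A}] \<V> (?\<tau> x) (\<mu> x A)"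
    by metis
  \<comment> \<open>Seeing \<open>x\<close> and \<open>A\<close>, Nimue can follow the strategy chosen for that opening.\<close>
  let ?\<nu> = "\<lambda>x A. \<mu> x A 0 A"
  have pos: "winning_strategy [0 \<mapsto> {A}] \<V> (?\<tau> x) (\<mu> x A) \<and>
      position [0 \<mapsto> {A}] \<V> (?\<tau> x) (\<mu> x A) 0 A h"
    if p: "position \<U> \<V> \<sigma> ?\<nu> x A h" for x A h
    using position_opening[OF p] \<mu> position_change_opening[OF p] by simp
  have "winning_strategy \<U> \<V> \<sigma> ?\<nu>"
    unfolding winning_strategy_def
  proof (intro conjI allI impI notI)
    fix x A h
    assume "position \<U> \<V> \<sigma> ?\<nu> x A h"
    from pos[OF this] show "winning_output \<sigma> x A h \<or> legal_query \<V> \<sigma> ?\<nu> x A h"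
      unfolding winning_strategy_def winning_output_def legal_query_def visible_def list.sel
      by blast
  next
    assume "\<exists>x A r. \<forall>n. position \<U> \<V> \<sigma> ?\<nu> x A (map r [0..<n])"
    with pos show False
      unfolding winning_strategy_def by blast
  qed
  then show thesis ..
qed

text \<open>
  This turns the game into a statement about Arthur alone: as Nimue sees the whole opening, the
  choice of her strategy moves inside the quantifiers over \<open>x\<close> and \<open>A\<close>, hence into \<open>beats\<close>.
\<close>

lemma LT_reducible_iff_beats:
  "\<U> \<le>\<^sub>L\<^sub>T \<V> \<longleftrightarrow> (\<exists>\<sigma>. partial_computable \<sigma> \<and>
     (\<forall>x\<in>dom \<U>. \<forall>A\<in>the (\<U> x). beats \<V> (\<lambda>xs. \<sigma> (x # xs)) A))"
  (is "_ \<longleftrightarrow> ?rhs")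
proof
  assume "\<U> \<le>\<^sub>L\<^sub>T \<V>"
  then obtain \<sigma> \<nu> where "partial_computable \<sigma>" "winning_strategy \<U> \<V> \<sigma> \<nu>"
    unfolding LT_reducible_def by blast
  then show ?rhs
    by (intro exI[of _ \<sigma>] conjI ballI winning_strategy_beats)
next
  assume ?rhs
  then obtain \<sigma> where "partial_computable \<sigma>"
    and beats: "\<And>x A. x \<in> dom \<U> \<Longrightarrow> A \<in> the (\<U> x) \<Longrightarrow> beats \<V> (\<lambda>xs. \<sigma> (x # xs)) A"
    by blast
  moreover obtain \<nu> where "winning_strategy \<U> \<V> \<sigma> \<nu>"
    by (rule beats_winning_strategy[OF beats])
  ultimately show "\<U> \<le>\<^sub>L\<^sub>T \<V>"
    unfolding LT_reducible_def by blast
qed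

lemma LT_reducible_upper_set_iff:
  "useq_of_upper_set \<U> \<le>\<^sub>L\<^sub>T \<V> \<longleftrightarrow>
     (\<exists>\<sigma>. partial_computable \<sigma> \<and> (\<forall>A\<in>\<U>. beats \<V> (\<lambda>xs. \<sigma> (0 # xs)) A))"
  by (simp add: LT_reducible_iff_beats useq_of_upper_set_def)

lemma LT_reducible_multifun_iff:
  "useq_of_multifun F \<le>\<^sub>L\<^sub>T \<V> \<longleftrightarrow>
     (\<exists>\<sigma>. partial_computable \<sigma> \<and>
       (\<forall>n\<in>dom F. \<forall>A. the (F n) \<subseteq> A \<longrightarrow> beats \<V> (\<lambda>xs. \<sigma> (n # xs)) A))"
proof -
  have "dom (useq_of_multifun F) = dom F"
    by (auto simp: useq_of_multifun_def)
  moreover have "the (useq_of_multifun F n) = {A. the (F n) \<subseteq> A}" if "n \<in> dom F" for n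
    using that by (auto simp: useq_of_multifun_def)
  ultimately show ?thesis
    by (simp add: LT_reducible_iff_beats)
qed

section \<open>Upper sets and their functions\<close>

lemma U_function_LT_reducible:
  assumes up: "upper_set \<U>" and red: "useq_of_upper_set \<U> \<le>\<^sub>L\<^sub>T \<V>" and F: "U_function \<U> F"
  shows "useq_of_multifun F \<le>\<^sub>L\<^sub>T \<V>"
proof -
  from red obtain \<sigma> where pc: "partial_computable \<sigma>"
    and \<sigma>: "\<And>A. A \<in> \<U> \<Longrightarrow> beats \<V> (\<lambda>xs. \<sigma> (0 # xs)) A"
    unfolding LT_reducible_upper_set_iff by blast
  from pc obtain \<sigma>' where "partial_computable \<sigma>'" and "\<And>x xs. \<sigma>' (x # xs) = \<sigma> (0 # xs)"
    by (rule partial_computable_replace_head[where a = 0]) blast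
  moreover have "A \<in> \<U>" if "n \<in> dom F" "the (F n) \<subseteq> A" for n A
    using that up F unfolding upper_set_def U_function_def by blast
  ultimately show ?thesis
    unfolding LT_reducible_multifun_iff using \<sigma> by (intro exI[of _ \<sigma>']) simp
qed

instance recf :: countable
  by countable_datatype

text \<open>
  The diagonal argument: \<open>A n\<close> is chosen so that the \<open>n\<close>-th program loses from the opening
  \<open>(n, A n)\<close>, which is possible as long as no program at all reduces \<open>\<U>\<close>.
\<close>

lemma LT_reducible_if_total_U_functions:
  assumes red: "\<And>F. total_U_function \<U> F \<Longrightarrow> useq_of_multifun F \<le>\<^sub>L\<^sub>T \<V>"
  shows "useq_of_upper_set \<U> \<le>\<^sub>L\<^sub>T \<V>"
proof (rule ccontr)
  assume not_red: "\<not> useq_of_upper_set \<U> \<le>\<^sub>L\<^sub>T \<V>"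
  define \<tau> :: "nat \<Rightarrow> arthur"
    where "\<tau> n xs = reval (from_nat n) [list_encode (n # xs)]" for n xs
  have "\<exists>A\<in>\<U>. \<not> beats \<V> (\<tau> n) A" for n
  proof -
    have "partial_computable (\<lambda>xs. reval (from_nat n) [list_encode xs])"
      unfolding partial_computable_def by blast
    then obtain \<sigma> where "partial_computable \<sigma>" and "\<And>x xs. \<sigma> (x # xs) = \<tau> n xs"
      unfolding \<tau>_def by (rule partial_computable_replace_head[where a = n]) blast
    moreover from this have "(\<lambda>xs. \<sigma> (0 # xs)) = \<tau> n"
      by (intro ext) simp
    ultimately show ?thesis
      using not_red unfolding LT_reducible_upper_set_iff by fastforce
  qed
  then obtain A where A: "\<And>n. A n \<in> \<U>" and fails: "\<And>n. \<not> beats \<V> (\<tau> n) (A n)"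
    by metis
  have "total_U_function \<U> (\<lambda>n. Some (A n))"
    using A by (auto simp: total_U_function_def U_function_def)
  from red[OF this] obtain \<sigma> where "partial_computable \<sigma>"
    and \<sigma>: "\<And>n. beats \<V> (\<lambda>xs. \<sigma> (n # xs)) (A n)"
    unfolding LT_reducible_multifun_iff by auto
  then obtain f where f: "\<And>xs. \<sigma> xs = reval f [list_encode xs]"
    unfolding partial_computable_def by blast
  have "(\<lambda>xs. \<sigma> (to_nat f # xs)) = \<tau> (to_nat f)"
    by (intro ext) (simp add: \<tau>_def f)
  with \<sigma>[of "to_nat f"] fails show False by simp
qed

theorem theoremG:
  fixes \<U> :: "nat set set" and \<V> :: "nat \<Rightarrow> nat set set option"
  assumes "upper_set \<U>" and "upper_sequence \<V>"
  shows "(useq_of_upper_set \<U> \<le>\<^sub>L\<^sub>T \<V> \<longleftrightarrow>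
            (\<forall>F. U_function \<U> F \<longrightarrow> useq_of_multifun F \<le>\<^sub>L\<^sub>T \<V>)) \<and>
         ((\<forall>F. U_function \<U> F \<longrightarrow> useq_of_multifun F \<le>\<^sub>L\<^sub>T \<V>) \<longleftrightarrow>
            (\<forall>F. total_U_function \<U> F \<longrightarrow> useq_of_multifun F \<le>\<^sub>L\<^sub>T \<V>))"
proof -
  have "useq_of_multifun F \<le>\<^sub>L\<^sub>T \<V>"
    if "useq_of_upper_set \<U> \<le>\<^sub>L\<^sub>T \<V>" "U_function \<U> F" for F
    using U_function_LT_reducible assms(1) that by blast
  moreover have "U_function \<U> F" if "total_U_function \<U> F" for F
    using that by (simp add: total_U_function_def)
  ultimately show ?thesis
    using LT_reducible_if_total_U_functions by blast
qed

end
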